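(* Let $R$ be a commutative ring, $A$ an $R$-module in which $2$ and $3$ do not annihilate non-zero elements, and $(A,\mu)$ an $R$-algebra, possibly non-associative, with product $xy=\mu(x,y)$. Let $C^\bullet(A)$ be the graded Lie algebra of Hochschild cochains with quasi-differential $d=d_\mu=[\mu,\cdot\,]$. Then $(C^\bullet(A),d_\mu)$ is a coboundary quasi-differential graded Lie algebra, with degree zero element $I=\mathrm{id}_A\in C^0(A)$ and multiplication $\mu=d_\mu I$. In the adjoint representation the degree-zero element $I$ corresponds to the grading character: $$\mathrm{ad}_I(f)=-p\, f\qquad\text{for } f\in C^p(A),$$ and Bianchi's identity holds: $$d\alpha_\mu=0,\qquad \alpha_\mu(x,y,z)=(xy)z-x(yz),$$ where $\alpha_\mu$ is the associator (curvature) defined by $2\alpha_\mu=d\mu$. Moreover $$d^2s=[\alpha_\mu,s]\qquad\text{for all } s\in C^\bullet(A).$$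
   Context: $C^\bullet(A)=\bigoplus_{p\ge-1}C^p(A)$ with $C^p(A)=\mathrm{Hom}_R(A^{\otimes(p+1)},A)$ in degree $p$ (so $C^{-1}(A)=A$, $\mu\in C^1(A)$). For $f\in C^p(A)$, $g\in C^q(A)$, $1\le i\le p+1$, let $$(f\circ_i g)(a_1,\dots,a_{p+q+1})=f(a_1,\dots,a_{i-1},g(a_i,\dots,a_{i+q}),a_{i+q+1},\dots,a_{p+q+1}),$$ $f\circ g=\sum_{i=1}^{p+1}(-1)^{(i-1)q}f\circ_i g\in C^{p+q}(A)$, which is zero when $p=-1$. The graded commutator $[f,g]=f\circ g-(-1)^{pq}g\circ f$ makes $C^\bullet(A)$ a graded Lie algebra, and $\mathrm{ad}_f(g)=[f,g]$. A quasi-differential graded Lie algebra is a graded Lie algebra $C^\bullet$ with a degree-one graded derivation $d$ of the bracket, where $d^2$ may be non-zero. It is called coboundary if there is a degree-zero element $I$ such that the element $\mu=dI$ (called the multiplication, or torsion) satisfies $d=\mathrm{ad}_\mu$. Its associator (or curvature) $\alpha$ is then defined by $2\alpha=d\mu$; since $d\mu=[\mu,\mu]=2\,\mu\circ\mu$ in $C^\bullet(A)$ and $2$ annihilates no non-zero element, this is well defined. *)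

theory Defs
  imports Complex_Main "HOL-Library.Function_Algebras"
begin

section \<open>Graded Lie algebras with a quasi-differential\<close>

text \<open>\<open>koszul k x\<close> is $(-1)^k x$; the exponent is an integer because degrees may be $-1$.\<close>

definition koszul :: "int \<Rightarrow> 'a::ab_group_add \<Rightarrow> 'a" where
  "koszul k x = (if even k then x else - x)"

text \<open>The sum of a family of submodules of one ambient module.\<close>

definition graded_sum :: "('r::comm_ring_1 \<Rightarrow> 'c::ab_group_add \<Rightarrow> 'c) \<Rightarrow> (int \<Rightarrow> 'c set) \<Rightarrow> 'c set" where
  "graded_sum scale C = module.span scale (\<Union>p. C p)"

text \<open>The homogeneous parts live in an ambient module that may be larger than their direct sum
  \<^term>\<open>graded_sum scale C\<close>, so all laws are imposed on elements of the sum only.\<close>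

locale graded_module = module scale
  for scale :: "'r::comm_ring_1 \<Rightarrow> 'c::ab_group_add \<Rightarrow> 'c" +
  fixes C :: "int \<Rightarrow> 'c set"
  assumes subspace_part: "subspace (C p)"
    and direct: "\<lbrakk>finite P; \<And>p. p \<in> P \<Longrightarrow> x p \<in> C p; (\<Sum>p\<in>P. x p) = 0; p \<in> P\<rbrakk> \<Longrightarrow> x p = 0"

locale graded_lie_algebra = graded_module scale C
  for scale :: "'r::comm_ring_1 \<Rightarrow> 'c::ab_group_add \<Rightarrow> 'c" and C :: "int \<Rightarrow> 'c set" +
  fixes br :: "'c \<Rightarrow> 'c \<Rightarrow> 'c"
  assumes br_add_left:
      "\<lbrakk>x \<in> graded_sum scale C; y \<in> graded_sum scale C; z \<in> graded_sum scale C\<rbrakk> \<Longrightarrow> br (x + y) z = br x z + br y z"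
    and br_add_right:
      "\<lbrakk>x \<in> graded_sum scale C; y \<in> graded_sum scale C; z \<in> graded_sum scale C\<rbrakk> \<Longrightarrow> br x (y + z) = br x y + br x z"
    and br_scale_left:
      "\<lbrakk>x \<in> graded_sum scale C; y \<in> graded_sum scale C\<rbrakk> \<Longrightarrow> br (scale r x) y = scale r (br x y)"
    and br_scale_right:
      "\<lbrakk>x \<in> graded_sum scale C; y \<in> graded_sum scale C\<rbrakk> \<Longrightarrow> br x (scale r y) = scale r (br x y)"
    and br_degree: "\<lbrakk>x \<in> C p; y \<in> C q\<rbrakk> \<Longrightarrow> br x y \<in> C (p + q)"
    and br_antisym: "\<lbrakk>x \<in> C p; y \<in> C q\<rbrakk> \<Longrightarrow> br x y = - koszul (p * q) (br y x)"
    and br_jacobi: "\<lbrakk>x \<in> C p; y \<in> C q; z \<in> C r'\<rbrakk> \<Longrightarrow>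
      br x (br y z) = br (br x y) z + koszul (p * q) (br y (br x z))"

text \<open>No condition on \<^term>\<open>d \<circ> d\<close> is imposed.\<close>

locale quasi_dgla = graded_lie_algebra scale C br
  for scale :: "'r::comm_ring_1 \<Rightarrow> 'c::ab_group_add \<Rightarrow> 'c" and C :: "int \<Rightarrow> 'c set"
    and br :: "'c \<Rightarrow> 'c \<Rightarrow> 'c" +
  fixes d :: "'c \<Rightarrow> 'c"
  assumes d_add: "\<lbrakk>x \<in> graded_sum scale C; y \<in> graded_sum scale C\<rbrakk> \<Longrightarrow> d (x + y) = d x + d y"
    and d_scale: "x \<in> graded_sum scale C \<Longrightarrow> d (scale r x) = scale r (d x)"
    and d_degree: "x \<in> C p \<Longrightarrow> d x \<in> C (p + 1)"
    and d_derivation: "\<lbrakk>x \<in> C p; y \<in> C q\<rbrakk> \<Longrightarrow> d (br x y) = br (d x) y + koszul p (br x (d y))"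

text \<open>The multiplication (torsion) is \<^term>\<open>d I\<close>.\<close>

locale coboundary_quasi_dgla = quasi_dgla scale C br d
  for scale :: "'r::comm_ring_1 \<Rightarrow> 'c::ab_group_add \<Rightarrow> 'c" and C :: "int \<Rightarrow> 'c set"
    and br :: "'c \<Rightarrow> 'c \<Rightarrow> 'c" and d :: "'c \<Rightarrow> 'c" +
  fixes I :: 'c
  assumes I_degree: "I \<in> C 0"
    and d_inner: "s \<in> graded_sum scale C \<Longrightarrow> d s = br (d I) s"

text \<open>The associator (curvature): the element \<open>\<alpha>\<close> with $2\alpha = d\mu$ for $\mu = dI$. It is
  meaningful only where existence and uniqueness hold.\<close>

definition curvature ::
    "('r::comm_ring_1 \<Rightarrow> 'c::ab_group_add \<Rightarrow> 'c) \<Rightarrow> (int \<Rightarrow> 'c set) \<Rightarrow> ('c \<Rightarrow> 'c) \<Rightarrow> 'c \<Rightarrow> 'c" where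
  "curvature scale C d I = (THE \<alpha>. \<alpha> \<in> C 2 \<and> scale 2 \<alpha> = d (d I))"


section \<open>Hochschild cochains\<close>

text \<open>A linear map out of the tensor power $A^{\otimes n}$ is a multilinear map on lists of
  length $n$. All degrees share the type \<^typ>\<open>'a list \<Rightarrow> 'a\<close>: a cochain of degree \<open>p\<close> is zero on
  lists of length other than \<open>p + 1\<close>, and a sum of cochains of different degrees
  is recovered from its values on lists of different lengths. The part of degree \<open>p < - 1\<close> is zero.\<close>

type_synonym 'a cochain = "'a list \<Rightarrow> 'a"

definition cscale :: "('r \<Rightarrow> 'a \<Rightarrow> 'a) \<Rightarrow> 'r \<Rightarrow> 'a cochain \<Rightarrow> 'a cochain" where
  "cscale scale r f = (\<lambda>as. scale r (f as))"

definition cochains ::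
    "('r::comm_ring_1 \<Rightarrow> 'a::ab_group_add \<Rightarrow> 'a) \<Rightarrow> int \<Rightarrow> 'a cochain set" where
  "cochains scale p = {f.
     (\<forall>as. int (length as) \<noteq> p + 1 \<longrightarrow> f as = 0) \<and>
     (\<forall>xs ys. int (length xs + 1 + length ys) = p + 1 \<longrightarrow>
        module_hom scale scale (\<lambda>x. f (xs @ x # ys)))}"

text \<open>\<open>partial_circ q i f g\<close> is $f \circ_i g$ for $g$ of degree $q$, with $i$ counted from 1.\<close>

definition partial_circ :: "int \<Rightarrow> nat \<Rightarrow> 'a cochain \<Rightarrow> 'a cochain \<Rightarrow> 'a cochain" where
  "partial_circ q i f g = (\<lambda>as.
     f (take (i - 1) as @ [g (take (nat (q + 1)) (drop (i - 1) as))] @ drop (nat (int i + q)) as))"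

definition circ ::
    "int \<Rightarrow> int \<Rightarrow> 'a::ab_group_add cochain \<Rightarrow> 'a cochain \<Rightarrow> 'a cochain" where
  "circ p q f g = (\<lambda>as. if int (length as) = p + q + 1
     then \<Sum>i = 1..nat (p + 1). koszul ((int i - 1) * q) (partial_circ q i f g as) else 0)"

definition hom_bracket ::
    "int \<Rightarrow> int \<Rightarrow> 'a::ab_group_add cochain \<Rightarrow> 'a cochain \<Rightarrow> 'a cochain" where
  "hom_bracket p q f g = circ p q f g - koszul (p * q) (circ q p g f)"

definition component :: "int \<Rightarrow> 'a::ab_group_add cochain \<Rightarrow> 'a cochain" where
  "component p f = (\<lambda>as. if int (length as) = p + 1 then f as else 0)"

definition degrees :: "'a::ab_group_add cochain \<Rightarrow> int set" where
  "degrees f = {p. component p f \<noteq> 0}"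

text \<open>The biadditive extension of \<^const>\<open>hom_bracket\<close> to the direct sum, whose elements
  have finitely many degrees.\<close>

definition gbracket :: "'a::ab_group_add cochain \<Rightarrow> 'a cochain \<Rightarrow> 'a cochain" where
  "gbracket f g =
     (\<Sum>p\<in>degrees f. \<Sum>q\<in>degrees g. hom_bracket p q (component p f) (component q g))"

definition id_cochain :: "'a::zero cochain" where
  "id_cochain as = (case as of [x] \<Rightarrow> x | _ \<Rightarrow> 0)"

definition mult_cochain :: "('a \<Rightarrow> 'a \<Rightarrow> 'a::zero) \<Rightarrow> 'a cochain" where
  "mult_cochain \<mu> as = (case as of [x, y] \<Rightarrow> \<mu> x y | _ \<Rightarrow> 0)"

definition hochschild_d :: "('a \<Rightarrow> 'a \<Rightarrow> 'a::ab_group_add) \<Rightarrow> 'a cochain \<Rightarrow> 'a cochain" where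
  "hochschild_d \<mu> = gbracket (mult_cochain \<mu>)"

definition associator ::
    "('r::comm_ring_1 \<Rightarrow> 'a::ab_group_add \<Rightarrow> 'a) \<Rightarrow> ('a \<Rightarrow> 'a \<Rightarrow> 'a) \<Rightarrow> 'a cochain" where
  "associator scale \<mu> = curvature (cscale scale) (cochains scale) (hochschild_d \<mu>) id_cochain"

end

theory Submission imports Defs begin

text \<open>Inserting a cochain into a list of arguments is an operation \<open>contract i n g\<close> on lists. Two
  insertions are either nested or commute after a shift of positions. In $(f \circ g) \circ h$ the
  nested ones make up $f \circ (g \circ h)$, and the others are symmetric in \<open>g\<close> and \<open>h\<close> up to the
  sign $(-1)^{qr}$. So \<open>\<circ>\<close> is a graded pre-Lie product, and its commutator satisfies the graded Jacobi
  identity. With $\mu$ in the first two slots this gives $2 d^2 s = [d\mu, s] = 2 [\alpha, s]$, and with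
  $\mu$ in all three $3 [\mu, [\mu, \mu]] = 0$; the torsion hypotheses on \<open>A\<close> finish the proof.\<close>

section \<open>Signs\<close>

lemma koszul_0 [simp]: "koszul k 0 = 0"
  by (simp add: koszul_def)

lemma koszul_zero_exponent [simp]: "koszul 0 x = x"
  by (simp add: koszul_def)

lemma koszul_koszul [simp]: "koszul k (koszul l x) = koszul (k + l) x"
  by (auto simp: koszul_def)

lemma koszul_double: "koszul (2 * k) x = x"
  by (simp add: koszul_def)

lemma koszul_cong: "even (k - l) \<Longrightarrow> koszul k x = koszul l x"
  by (auto simp: koszul_def)

lemma koszul_sum: "koszul k (\<Sum>i\<in>A. x i) = (\<Sum>i\<in>A. koszul k (x i))"
  by (simp add: koszul_def sum_negf)

lemma koszul_apply: "koszul k f as = koszul k (f as)"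
  by (simp add: koszul_def)

lemma koszul_add: "koszul k (x + y) = koszul k x + koszul k y"
  by (simp add: koszul_def)

lemma koszul_minus: "koszul k (- x) = - koszul k x"
  by (simp add: koszul_def)

section \<open>Insertions into lists of arguments\<close>

text \<open>Positions count from 0 and \<open>n\<close> is the arity of \<open>g\<close>, so
  \<open>f (contract i n g as)\<close> is the partial composition with index \<open>i + 1\<close>.
  Leaving out \<open>f\<close> turns relations between partial compositions into equations between
  lists.\<close>

definition contract :: "nat \<Rightarrow> nat \<Rightarrow> 'a cochain \<Rightarrow> 'a list \<Rightarrow> 'a list" where
  "contract i n g as = take i as @ g (take n (drop i as)) # drop (i + n) as"

lemma contract_append:
  "\<lbrakk>as = xs @ us @ ys; length xs = i; length us = n\<rbrakk> \<Longrightarrow> contract i n g as = xs @ g us # ys"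
  by (auto simp: contract_def)

lemma length_contract: "i + n \<le> length as \<Longrightarrow> length (contract i n g as) = length as - n + 1"
  by (simp add: contract_def)

lemma split_list_at:
  assumes "i + n \<le> length as"
  obtains xs us ys where "as = xs @ us @ ys" "length xs = i" "length us = n"
proof
  show "as = take i as @ take n (drop i as) @ drop n (drop i as)"
    by (simp only: append_take_drop_id)
qed (use assms in simp_all)

text \<open>Inserting \<open>h\<close> first collapses \<open>l\<close> entries to the left of
  position \<open>i\<close> into one, so position \<open>i\<close> of the shortened list is position
  \<open>i + l - 1\<close> of the original. Since \<open>k < i\<close>, this subtraction never
  truncates, even for \<open>l = 0\<close>.\<close>

lemma contract_commute:
  assumes "k < i" "i + l - 1 + n \<le> length as"
  shows "contract i n g (contract k l h as) = contract k l h (contract (i + l - 1) n g as)"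
proof -
  obtain zs gs ys where as: "as = zs @ gs @ ys" and zs: "length zs = i + l - 1" and gs: "length gs = n"
    using split_list_at[OF assms(2)] .
  have "k + l \<le> length zs" using assms zs by simp
  then obtain xs hs ws where z: "zs = xs @ hs @ ws" and xs: "length xs = k" and hs: "length hs = l"
    by (rule split_list_at)
  have ws: "length ws = i - k - 1" using z zs xs hs assms by simp
  have "contract k l h as = xs @ h hs # ws @ gs @ ys"
    by (rule contract_append) (simp_all add: as z xs hs)
  then have "contract i n g (contract k l h as) = (xs @ h hs # ws) @ g gs # ys"
    by (intro contract_append) (use assms xs ws gs in simp_all)
  moreover have "contract (i + l - 1) n g as = zs @ g gs # ys"
    by (rule contract_append) (simp_all add: as zs gs)
  then have "contract k l h (contract (i + l - 1) n g as) = xs @ h hs # ws @ g gs # ys"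
    by (intro contract_append) (simp_all add: z xs hs)
  ultimately show ?thesis by simp
qed

text \<open>The value of \<open>h\<close> becomes argument \<open>j\<close> of \<open>g\<close>, so
  both insertions act on one block of \<open>n + l - 1\<close> entries. The condition
  \<open>j < n\<close> forces \<open>n > 0\<close>, which keeps this count correct for
  \<open>l = 0\<close>.\<close>

lemma contract_nested:
  assumes "j < n" "i + (n + l - 1) \<le> length as"
  shows "contract i n g (contract (i + j) l h as) = contract i (n + l - 1) (\<lambda>bs. g (contract j l h bs)) as"
proof -
  obtain xs us ys where as: "as = xs @ us @ ys" and xs: "length xs = i" and us: "length us = n + l - 1"
    using split_list_at[OF assms(2)] .
  have "j + l \<le> length us" using assms us by simp
  then obtain vs hs ws where u: "us = vs @ hs @ ws" and vs: "length vs = j" and hs: "length hs = l"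
    by (rule split_list_at)
  have ws: "length ws = n - 1 - j" using u us vs hs assms by simp
  have "contract (i + j) l h as = (xs @ vs) @ h hs # ws @ ys"
    by (rule contract_append) (simp_all add: as u xs vs hs)
  then have "contract i n g (contract (i + j) l h as) = xs @ g (vs @ h hs # ws) # ys"
    by (intro contract_append) (use assms xs vs ws in simp_all)
  moreover have "contract j l h us = vs @ h hs # ws"
    by (rule contract_append) (simp_all add: u vs hs)
  moreover have "contract i (n + l - 1) (\<lambda>bs. g (contract j l h bs)) as = xs @ g (contract j l h us) # ys"
    by (rule contract_append) (simp_all add: as xs us)
  ultimately show ?thesis by simp
qed

section \<open>The composition product and its linearity on the left\<close>

text \<open>Trading degrees for the arities \<open>m\<close> and \<open>n\<close> makes all indices
  natural numbers and starts positions at 0. Arity 0, that is degree \<open>- 1\<close>, is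
  included.\<close>

lemma circ_arity:
  "circ (int m - 1) (int n - 1) f g as = (if length as + 1 = m + n
     then \<Sum>i<m. koszul (int i * (int n - 1)) (f (contract i n g as)) else 0)"
proof -
  have "(\<Sum>i = 1..m. koszul ((int i - 1) * (int n - 1)) (partial_circ (int n - 1) i f g as))
      = (\<Sum>i<m. koszul (int i * (int n - 1)) (f (contract i n g as)))"
  proof (rule sum.reindex_bij_witness[of _ Suc "\<lambda>i. i - 1"])
    fix i assume "i \<in> {1..m}"
    then obtain j where j: "i = Suc j" by (cases i) auto
    have "nat (1 + int j + (int n - 1)) = j + n" by simp
    then show "koszul (int (i - 1) * (int n - 1)) (f (contract (i - 1) n g as)) =
         koszul ((int i - 1) * (int n - 1)) (partial_circ (int n - 1) i f g as)"
      by (simp add: j partial_circ_def contract_def)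
  qed auto
  then show ?thesis
    by (auto simp: circ_def)
qed

lemma circ_zero_left [simp]: "circ p q 0 g = 0"
  by (simp add: circ_def partial_circ_def fun_eq_iff)

lemma circ_low_left: "p < 0 \<Longrightarrow> circ p q f g = 0"
  by (simp add: circ_def fun_eq_iff)

lemma circ_add_left: "circ p q (f + f') g = circ p q f g + circ p q f' g"
  by (simp add: circ_def partial_circ_def koszul_add sum.distrib fun_eq_iff)

lemma circ_minus_left: "circ p q (- f) g = - circ p q f g"
  by (simp add: circ_def partial_circ_def koszul_minus sum_negf fun_eq_iff)

lemma circ_diff_left: "circ p q (f - f') g = circ p q f g - circ p q f' g"
  using circ_add_left[of p q f "- f'" g] by (simp add: circ_minus_left)

lemma component_zero [simp]: "component p 0 = 0"
  by (simp add: component_def fun_eq_iff)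

lemma component_add: "component p (f + g) = component p f + component p g"
  by (simp add: component_def fun_eq_iff)

lemma degrees_add: "degrees (f + g) \<subseteq> degrees f \<union> degrees g"
  by (auto simp: degrees_def component_add)

section \<open>Modules of multilinear cochains\<close>

context module
begin

lemma module_hom_koszul:
  "module_hom scale scale f \<Longrightarrow> module_hom scale scale (\<lambda>x. koszul k (f x))"
  by (auto simp: koszul_def module_hom_iff)

lemma koszul_scale: "koszul k (scale c x) = scale c (koszul k x)"
  by (simp add: koszul_def)

lemma koszul_cscale: "koszul k (cscale scale c f) = cscale scale c (koszul k f)"
  by (simp add: koszul_def cscale_def fun_eq_iff)

lemma cochains_eq_0: "\<lbrakk>f \<in> cochains scale p; int (length as) \<noteq> p + 1\<rbrakk> \<Longrightarrow> f as = 0"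
  by (simp add: cochains_def)

lemma cochains_hom:
  assumes "f \<in> cochains scale p"
  shows "module_hom scale scale (\<lambda>x. f (xs @ x # ys))"
proof (cases "int (length xs + 1 + length ys) = p + 1")
  case True
  then show ?thesis using assms by (simp add: cochains_def)
next
  case False
  then have "f (xs @ x # ys) = 0" for x
    by (intro cochains_eq_0[OF assms]) simp
  then show ?thesis by (simp add: module_hom_iff module_axioms)
qed

lemma cochainsI:
  assumes "\<And>as. int (length as) \<noteq> p + 1 \<Longrightarrow> f as = 0"
    and "\<And>xs ys. int (length xs + 1 + length ys) = p + 1 \<Longrightarrow> module_hom scale scale (\<lambda>x. f (xs @ x # ys))"
  shows "f \<in> cochains scale p"
  using assms by (simp add: cochains_def)

lemma cochains_low: "\<lbrakk>f \<in> cochains scale p; p < - 1\<rbrakk> \<Longrightarrow> f = 0"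
  by (force simp: cochains_def fun_eq_iff)

text \<open>No nonzero cochain lives below degree \<open>- 1\<close>, so apart from zero every
  cochain has a natural number as arity.\<close>

lemma cochains_cases:
  assumes "f \<in> cochains scale p"
  obtains "f = 0" | m where "p = int m - 1"
proof (cases "p < - 1")
  case True
  then show ?thesis using that assms cochains_low by blast
next
  case False
  then have "p = int (nat (p + 1)) - 1" by simp
  then show ?thesis using that by blast
qed

lemma module_cscale: "module (cscale scale)"
  by unfold_locales (simp_all add: cscale_def fun_eq_iff algebra_simps)

lemma subspace_cochains: "module.subspace (cscale scale) (cochains scale p)"
  unfolding module.subspace_def[OF module_cscale]
  by (auto simp: cochains_def cscale_def module_hom_iff module_axioms algebra_simps)

lemma zero_in_cochains [simp]: "0 \<in> cochains scale p"
  by (rule module.subspace_0[OF module_cscale subspace_cochains])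

lemma neg_in_cochains: "f \<in> cochains scale p \<Longrightarrow> - f \<in> cochains scale p"
  by (rule module.subspace_neg[OF module_cscale subspace_cochains])

lemma add_in_cochains:
  "\<lbrakk>f \<in> cochains scale p; g \<in> cochains scale p\<rbrakk> \<Longrightarrow> f + g \<in> cochains scale p"
  by (rule module.subspace_add[OF module_cscale subspace_cochains])

lemma scale_in_cochains: "f \<in> cochains scale p \<Longrightarrow> cscale scale c f \<in> cochains scale p"
  by (rule module.subspace_scale[OF module_cscale subspace_cochains])

lemma diff_in_cochains:
  "\<lbrakk>f \<in> cochains scale p; g \<in> cochains scale p\<rbrakk> \<Longrightarrow> f - g \<in> cochains scale p"
  by (rule module.subspace_diff[OF module_cscale subspace_cochains])

lemma koszul_in_cochains: "f \<in> cochains scale p \<Longrightarrow> koszul k f \<in> cochains scale p"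
  by (simp add: koszul_def neg_in_cochains)

text \<open>The sum enters an argument slot of \<open>f\<close>, so multilinearity of
  \<open>f\<close> is used here; linearity in the left factor is pointwise and holds for arbitrary
  functions.\<close>

lemma circ_add_right:
  "f \<in> cochains scale p \<Longrightarrow> circ p q f (g + g') = circ p q f g + circ p q f g'"
  by (simp add: circ_def partial_circ_def koszul_add sum.distrib fun_eq_iff
      module_hom.add[OF cochains_hom])

lemma circ_scale_right:
  "f \<in> cochains scale p \<Longrightarrow> circ p q f (cscale scale c g) = cscale scale c (circ p q f g)"
  by (simp add: circ_def partial_circ_def cscale_def koszul_scale scale_sum_right fun_eq_iff
      module_hom.scale[OF cochains_hom])

lemma circ_scale_left: "circ p q (cscale scale c f) g = cscale scale c (circ p q f g)"
  by (simp add: circ_def partial_circ_def cscale_def koszul_scale scale_sum_right fun_eq_iff)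

lemma circ_minus_right: "f \<in> cochains scale p \<Longrightarrow> circ p q f (- g) = - circ p q f g"
  using circ_scale_right[of f p q "- 1" g] by (simp add: cscale_def fun_Compl_def)

lemma circ_diff_right:
  "f \<in> cochains scale p \<Longrightarrow> circ p q f (g - g') = circ p q f g - circ p q f g'"
  using circ_add_right[of f p q g "- g'"] by (simp add: circ_minus_right)

lemma circ_zero_right [simp]: "f \<in> cochains scale p \<Longrightarrow> circ p q f 0 = 0"
  using circ_add_right[of f p q 0 0] by simp

text \<open>Each summand is linear in a chosen argument \<open>x\<close>: by linearity of
  \<open>f\<close> if \<open>x\<close> stands before or after the block fed to \<open>g\<close>, and
  as a composite of two linear maps if \<open>x\<close> stands inside it.\<close>

lemma circ_in_cochains:
  assumes f: "f \<in> cochains scale p" and g: "g \<in> cochains scale q"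
  shows "circ p q f g \<in> cochains scale (p + q)"
  using f
proof (cases rule: cochains_cases)
  case 1
  then show ?thesis by simp
next
  case (2 m)
  note m = this
  show ?thesis
    using g
  proof (cases rule: cochains_cases)
    case 1
    then show ?thesis using circ_zero_right[OF f] by simp
  next
    case (2 n)
    have f': "f \<in> cochains scale (int m - 1)" and g': "g \<in> cochains scale (int n - 1)"
      using f g m 2 by simp_all
    show ?thesis
    proof (rule cochainsI)
      show "circ p q f g as = 0" if "int (length as) \<noteq> p + q + 1" for as
        using that by (simp add: circ_def)
      fix xs ys :: "'b list" assume "int (length xs + 1 + length ys) = p + q + 1"
      then have len: "length xs + 1 + length ys + 1 = m + n" using m 2 by linarith
      have "module_hom scale scale (\<lambda>x. f (contract i n g (xs @ x # ys)))" if i: "i < m" for i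
      proof -
        consider "length xs < i" | "i \<le> length xs" "length xs < i + n" | "i + n \<le> length xs"
          by linarith
        then show ?thesis
        proof cases
          case 1
          then have "(i - length xs - 1) + n \<le> length ys" using len i by linarith
          then obtain vs us ws where ys: "ys = vs @ us @ ws" "length vs = i - length xs - 1" "length us = n"
            by (rule split_list_at)
          have "contract i n g (xs @ x # ys) = (xs @ x # vs) @ g us # ws" for x
            by (rule contract_append) (use 1 ys in simp_all)
          moreover have "module_hom scale scale (\<lambda>x. f (xs @ x # (vs @ g us # ws)))"
            by (rule cochains_hom[OF f'])
          ultimately show ?thesis by simp
        next
          case 2
          define as us vs bs where "as = take i xs" and "us = drop i xs"
            and "vs = take (i + n - length xs - 1) ys" and "bs = drop (i + n - length xs - 1) ys"
          have xs: "xs = as @ us" and ys: "ys = vs @ bs"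
            by (simp_all add: as_def us_def vs_def bs_def)
          have l: "length as = i" "length us + 1 + length vs = n" "length as + 1 + length bs = m"
            using 2 len i by (auto simp: as_def us_def vs_def bs_def)
          have "contract i n g (xs @ x # ys) = as @ g (us @ x # vs) # bs" for x
            by (rule contract_append) (use l in \<open>simp_all add: xs ys\<close>)
          moreover have "module_hom scale scale (\<lambda>x. f (as @ x # bs))"
            by (rule cochains_hom[OF f'])
          moreover have "module_hom scale scale (\<lambda>x. g (us @ x # vs))"
            by (rule cochains_hom[OF g'])
          ultimately show ?thesis
            using module_hom_compose[of scale scale "\<lambda>x. g (us @ x # vs)" scale "\<lambda>x. f (as @ x # bs)"]
            by (simp add: o_def)
        next
          case 3
          then obtain as us vs where xs: "xs = as @ us @ vs" "length as = i" "length us = n"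
            by (rule split_list_at)
          have "contract i n g (xs @ x # ys) = as @ g us # (vs @ x # ys)" for x
            by (rule contract_append) (use xs in simp_all)
          moreover have "module_hom scale scale (\<lambda>x. f ((as @ g us # vs) @ x # ys))"
            by (rule cochains_hom[OF f'])
          ultimately show ?thesis by simp
        qed
      qed
      then show "module_hom scale scale (\<lambda>x. circ p q f g (xs @ x # ys))"
        unfolding m 2 circ_arity using len by (auto intro!: module_pair.module_hom_sum module_pair.intro module_axioms module_hom_koszul)
    qed
  qed
qed


section \<open>The graded pre-Lie identity\<close>

text \<open>Linearity of \<open>f\<close> pulls the inner sum out, and inserting \<open>h\<close> at
  \<open>j\<close> inside the block at \<open>i\<close> is inserting it at \<open>k = i + j\<close>
  in the whole list. The signs agree because \<open>i * (n - 1 + (l - 1)) + j * (l - 1)\<close>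
  equals \<open>i * (n - 1) + (i + j) * (l - 1)\<close>.\<close>

lemma circ_nested:
  assumes f: "f \<in> cochains scale (int m - 1)" and len: "length as + 2 = m + n + l"
  shows "circ (int m - 1) (int n - 1 + (int l - 1)) f (circ (int n - 1) (int l - 1) g h) as =
    (\<Sum>i<m. \<Sum>k=i..<i + n. koszul (int i * (int n - 1) + int k * (int l - 1))
      (f (contract i n g (contract k l h as))))"
\<comment> \<open>For \<open>n = 0\<close> both sides vanish: a left factor of degree
  \<open>- 1\<close> composes to zero, and the range of \<open>k\<close> is empty. Otherwise
  \<open>n + l - 1\<close> is the true arity of the inner composite.\<close>
proof (cases "n = 0")
  case True
  then show ?thesis using f by (simp add: circ_low_left)
next
  case False
  have *: "koszul (int i * (int n - 1 + (int l - 1)))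
      (f (contract i (n + l - 1) (circ (int n - 1) (int l - 1) g h) as)) =
     (\<Sum>k=i..<i + n. koszul (int i * (int n - 1) + int k * (int l - 1))
      (f (contract i n g (contract k l h as))))" if i: "i < m" for i
  proof -
    define us where "us = take (n + l - 1) (drop i as)"
    interpret F: module_hom scale scale "\<lambda>x. f (take i as @ x # drop (i + (n + l - 1)) as)"
      by (rule cochains_hom[OF f])
    have "length us + 1 = n + l"
      using len i False by (simp add: us_def)
    then have "f (contract i (n + l - 1) (circ (int n - 1) (int l - 1) g h) as) =
       f (take i as @ (\<Sum>j<n. koszul (int j * (int l - 1)) (g (contract j l h us))) # drop (i + (n + l - 1)) as)"
      by (simp add: contract_def[of i "n + l - 1" "circ (int n - 1) (int l - 1) g h"] circ_arity
          flip: us_def del: One_nat_def)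
    also have "\<dots> = (\<Sum>j<n. koszul (int j * (int l - 1))
        (f (contract i (n + l - 1) (\<lambda>bs. g (contract j l h bs)) as)))"
      unfolding F.sum by (intro sum.cong refl)
        (simp add: koszul_def module_hom.neg[OF cochains_hom[OF f]] contract_def[of i "n + l - 1"] us_def del: One_nat_def)
    also have "\<dots> = (\<Sum>j<n. koszul (int j * (int l - 1)) (f (contract i n g (contract (i + j) l h as))))"
      by (intro sum.cong refl arg_cong[of _ _ "koszul _"] arg_cong[of _ _ f] contract_nested[symmetric])
        (use len i in auto)
    also have "koszul (int i * (int n - 1 + (int l - 1))) \<dots> = (\<Sum>j<n. koszul (int i * (int n - 1) + int (i + j) * (int l - 1))
        (f (contract i n g (contract (i + j) l h as))))"
      by (simp add: koszul_sum algebra_simps)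
    also have "\<dots> = (\<Sum>k=i..<i + n. koszul (int i * (int n - 1) + int k * (int l - 1))
      (f (contract i n g (contract k l h as))))"
      using sum.shift_bounds_nat_ivl[of "\<lambda>k. koszul (int i * (int n - 1) + int k * (int l - 1))
      (f (contract i n g (contract k l h as)))" 0 i n]
      by (simp add: lessThan_atLeast0 add.commute)
    finally show ?thesis .
  qed
  have "int n - 1 + (int l - 1) = int (n + l - 1) - 1"
    using False by linarith
  then have "circ (int m - 1) (int n - 1 + (int l - 1)) f (circ (int n - 1) (int l - 1) g h) as =
      (\<Sum>i<m. koszul (int i * (int n - 1 + (int l - 1)))
        (f (contract i (n + l - 1) (circ (int n - 1) (int l - 1) g h) as)))"
    using len False by (simp only: circ_arity[of m "n + l - 1"]) simp
  then show ?thesis using * by simp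
qed

text \<open>The outer product puts \<open>h\<close> at \<open>k\<close> in the full list, the inner
  one then puts \<open>g\<close> at \<open>i\<close> in the shortened list. The summands are those
  of \<open>circ_nested\<close>, but \<open>k\<close> runs over all positions. The condition
  \<open>0 < m\<close> makes \<open>m + n - 1\<close> the arity of the inner composite.\<close>

lemma circ_iterated:
  assumes m: "0 < m" and len: "length as + 2 = m + n + l"
  shows "circ (int m - 1 + (int n - 1)) (int l - 1) (circ (int m - 1) (int n - 1) f g) h as =
    (\<Sum>i<m. \<Sum>k<m + n - 1. koszul (int i * (int n - 1) + int k * (int l - 1))
      (f (contract i n g (contract k l h as))))"
proof -
  have *: "length (contract k l h as) + 1 = m + n" if "k < m + n - 1" for k
    using that len by (subst length_contract) auto
  have deg: "int m - 1 + (int n - 1) = int (m + n - 1) - 1"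
    using m by linarith
  have "circ (int m - 1 + (int n - 1)) (int l - 1) (circ (int m - 1) (int n - 1) f g) h as =
     (\<Sum>k<m + n - 1. \<Sum>i<m. koszul (int i * (int n - 1) + int k * (int l - 1))
      (f (contract i n g (contract k l h as))))"
    unfolding deg circ_arity using * m len
    by (auto simp: koszul_sum add.commute intro!: sum.cong)
  then show ?thesis by (subst sum.swap)
qed

text \<open>The terms with \<open>k < i\<close> insert \<open>h\<close> to the left of \<open>g\<close>, those with \<open>k \<ge> i + n\<close> to the right.\<close>

lemma circ_associator:
  assumes f: "f \<in> cochains scale (int m - 1)" and m: "0 < m" and len: "length as + 2 = m + n + l"
  shows "circ (int m - 1 + (int n - 1)) (int l - 1) (circ (int m - 1) (int n - 1) f g) h as
      - circ (int m - 1) (int n - 1 + (int l - 1)) f (circ (int n - 1) (int l - 1) g h) as =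
    (\<Sum>i<m. \<Sum>k<i. koszul (int i * (int n - 1) + int k * (int l - 1))
      (f (contract i n g (contract k l h as)))) +
    (\<Sum>i<m. \<Sum>k=i + n..<m + n - 1. koszul (int i * (int n - 1) + int k * (int l - 1))
      (f (contract i n g (contract k l h as))))"
proof -
  have "sum t {..<m + n - 1} - sum t {i..<i + n} = sum t {..<i} + sum t {i + n..<m + n - 1}"
    if "i < m" for i and t :: "nat \<Rightarrow> 'b"
  proof -
    have "sum t {..<m + n - 1} = sum t {0..<i} + sum t {i..<i + n} + sum t {i + n..<m + n - 1}"
      using that by (simp add: sum.atLeastLessThan_concat lessThan_atLeast0)
    then show ?thesis by (simp add: lessThan_atLeast0)
  qed
  then show ?thesis
    unfolding circ_iterated[OF m len] circ_nested[OF f len] sum_subtractf[symmetric] sum.distrib[symmetric]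
    by (intro sum.cong) auto
qed

text \<open>By \<open>contract_commute\<close> the term at \<open>(i, k)\<close> with
  \<open>k < i\<close> matches the term at \<open>(k, i + l - 1)\<close> on the other side. With the
  prefactor included, the sign exponents differ by \<open>2 * (n - 1) * (l - 1)\<close>.\<close>

lemma contract_swap_sum:
  assumes len: "length as + 2 = m + n + l"
  shows "(\<Sum>i<m. \<Sum>k<i. koszul (int i * (int n - 1) + int k * (int l - 1))
      (f (contract i n g (contract k l h as)))) =
    koszul ((int n - 1) * (int l - 1)) (\<Sum>i<m. \<Sum>k=i + l..<m + l - 1.
      koszul (int i * (int l - 1) + int k * (int n - 1)) (f (contract i l h (contract k n g as))))"
  unfolding koszul_sum sum.Sigma[OF finite_lessThan ballI[OF finite_lessThan]]
    sum.Sigma[OF finite_lessThan ballI[OF finite_atLeastLessThan]]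
proof (rule sum.reindex_bij_witness[where i = "\<lambda>(i, k). (k + 1 - l, i)" and j = "\<lambda>(i, k). (k, i + l - 1)"])
  fix x assume "x \<in> (SIGMA i:{..<m}. {..<i})"
  then obtain i k where x: "x = (i, k)" and ki: "k < i" "i < m" by auto
  have "contract i n g (contract k l h as) = contract k l h (contract (i + l - 1) n g as)"
    by (rule contract_commute) (use ki len in auto)
  moreover have "int (i + l - 1) = int i + (int l - 1)"
    using ki by linarith
  ultimately show "koszul ((int n - 1) * (int l - 1)) (case case x of (i, k) \<Rightarrow> (k, i + l - 1) of
      (i, k) \<Rightarrow> koszul (int i * (int l - 1) + int k * (int n - 1))
        (f (contract i l h (contract k n g as)))) =
    (case x of (i, k) \<Rightarrow> koszul (int i * (int n - 1) + int k * (int l - 1))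
        (f (contract i n g (contract k l h as))))"
    by (auto simp: x algebra_simps intro!: koszul_cong)
qed auto

text \<open>By \<open>circ_associator\<close> each difference consists of terms with
  \<open>h\<close> to the left of \<open>g\<close> and terms with \<open>h\<close> to the right of
  \<open>g\<close>. Exchanging \<open>g\<close> and \<open>h\<close> swaps the two kinds at the cost
  of a sign.\<close>

lemma circ_pre_lie:
  assumes f: "f \<in> cochains scale p" and g: "g \<in> cochains scale q" and h: "h \<in> cochains scale r"
  shows "circ (p + q) r (circ p q f g) h - circ p (q + r) f (circ q r g h) =
    koszul (q * r) (circ (p + r) q (circ p r f h) g - circ p (r + q) f (circ r q h g))"
\<comment> \<open>These cases make both sides zero; in all others the degrees come from arities with
  \<open>0 < m\<close>.\<close>
proof (cases "f = 0 \<or> g = 0 \<or> h = 0 \<or> p = - 1")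
  case True
  then show ?thesis
    using f g h circ_in_cochains[OF f g] circ_in_cochains[OF f h] by (auto simp: circ_low_left)
next
  case False
  then obtain m n l where mnl: "p = int m - 1" "q = int n - 1" "r = int l - 1"
    using f g h by (meson cochains_cases)
  have m: "0 < m" using False mnl by auto
  show ?thesis
  proof (rule ext)
    fix as
    show "(circ (p + q) r (circ p q f g) h - circ p (q + r) f (circ q r g h)) as =
      koszul (q * r) (circ (p + r) q (circ p r f h) g - circ p (r + q) f (circ r q h g)) as"
    proof (cases "length as + 2 = m + n + l")
      case True
      then have True': "length as + 2 = m + l + n" by simp
      have f': "f \<in> cochains scale (int m - 1)" using f mnl by simp
      show ?thesis
        \<comment> \<open>Every sum over \<open>k < i\<close> becomes a sum of the other kind. On
          the right-hand side its sign then occurs twice and cancels by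
          \<open>koszul_double\<close>.\<close>
        unfolding koszul_apply minus_apply mnl circ_associator[OF f' m True] circ_associator[OF f' m True']
          contract_swap_sum[OF True] contract_swap_sum[OF True']
        by (simp add: koszul_add mult.commute[of "int l - 1"] koszul_double add.commute)
    next
      case False
      then show ?thesis by (auto simp: circ_def koszul_apply mnl)
    qed
  qed
qed

section \<open>The bracket of homogeneous cochains\<close>

text \<open>Expanded, the identity contains all six products nested to the left. Three instances of
  \<open>circ_pre_lie\<close> express three of them through the other three and products nested to
  the right; the rest cancels once the parities of the degrees are fixed.\<close>

lemma hom_bracket_jacobi:
  assumes f: "f \<in> cochains scale p" and g: "g \<in> cochains scale q" and h: "h \<in> cochains scale r"
  shows "hom_bracket p (q + r) f (hom_bracket q r g h) =
    hom_bracket (p + q) r (hom_bracket p q f g) h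
    + koszul (p * q) (hom_bracket q (p + r) g (hom_bracket p r f h))"
proof -
  have fgh: "circ (p + q) r (circ p q f g) h = circ p (q + r) f (circ q r g h) +
      koszul (q * r) (circ (p + r) q (circ p r f h) g - circ p (q + r) f (circ r q h g))"
    using circ_pre_lie[OF f g h] by (simp add: algebra_simps)
  have gfh: "circ (p + q) r (circ q p g f) h = circ q (p + r) g (circ p r f h) +
      koszul (p * r) (circ (q + r) p (circ q r g h) f - circ q (p + r) g (circ r p h f))"
    using circ_pre_lie[OF g f h] by (simp add: algebra_simps)
  have hfg: "circ (p + r) q (circ r p h f) g = circ r (p + q) h (circ p q f g) +
      koszul (p * q) (circ (q + r) p (circ r q h g) f - circ r (p + q) h (circ q p g f))"
    using circ_pre_lie[OF h f g] by (simp add: algebra_simps)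
  show ?thesis
    using f g h
    by (cases "even p"; cases "even q"; cases "even r")
      (simp_all add: fgh gfh hfg hom_bracket_def koszul_def circ_diff_left circ_diff_right circ_add_left
        circ_add_right circ_minus_left circ_minus_right algebra_simps)
qed


lemma hom_bracket_in_cochains:
  "\<lbrakk>f \<in> cochains scale p; g \<in> cochains scale q\<rbrakk> \<Longrightarrow> hom_bracket p q f g \<in> cochains scale (p + q)"
  unfolding hom_bracket_def
  by (metis add.commute circ_in_cochains diff_in_cochains koszul_in_cochains)

lemma hom_bracket_add_left:
  "g \<in> cochains scale q \<Longrightarrow> hom_bracket p q (f + f') g = hom_bracket p q f g + hom_bracket p q f' g"
  by (simp add: hom_bracket_def circ_add_left circ_add_right koszul_add)

lemma hom_bracket_add_right:
  "f \<in> cochains scale p \<Longrightarrow> hom_bracket p q f (g + g') = hom_bracket p q f g + hom_bracket p q f g'"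
  by (simp add: hom_bracket_def circ_add_left circ_add_right koszul_add)

lemma hom_bracket_scale_left:
  "g \<in> cochains scale q \<Longrightarrow> hom_bracket p q (cscale scale c f) g = cscale scale c (hom_bracket p q f g)"
  using module.scale_right_diff_distrib[OF module_cscale]
  by (simp add: hom_bracket_def circ_scale_left circ_scale_right koszul_cscale)

lemma hom_bracket_scale_right:
  "f \<in> cochains scale p \<Longrightarrow> hom_bracket p q f (cscale scale c g) = cscale scale c (hom_bracket p q f g)"
  using module.scale_right_diff_distrib[OF module_cscale]
  by (simp add: hom_bracket_def circ_scale_left circ_scale_right koszul_cscale)

lemma hom_bracket_zero_left [simp]: "g \<in> cochains scale q \<Longrightarrow> hom_bracket p q 0 g = 0"
  and hom_bracket_zero_right [simp]: "f \<in> cochains scale p \<Longrightarrow> hom_bracket p q f 0 = 0"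
  by (simp_all add: hom_bracket_def)

section \<open>Extension of the bracket to the direct sum\<close>

lemma component_cscale: "component p (cscale scale c f) = cscale scale c (component p f)"
  by (simp add: component_def cscale_def fun_eq_iff)

lemma component_homogeneous:
  "f \<in> cochains scale p \<Longrightarrow> component q f = (if q = p then f else 0)"
  by (auto simp: component_def fun_eq_iff intro: cochains_eq_0 cochains_eq_0[symmetric])

lemma degrees_homogeneous: "f \<in> cochains scale p \<Longrightarrow> degrees f \<subseteq> {p}"
  by (auto simp: degrees_def component_homogeneous)

lemma degrees_cscale: "degrees (cscale scale c f) \<subseteq> degrees f"
  by (auto simp: degrees_def component_cscale module.scale_zero_right[OF module_cscale])

text \<open>By induction on the span. Finiteness matters because \<open>gbracket\<close> sums over
  \<open>degrees\<close>, and a sum over an infinite set is 0 by default.\<close>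

lemma graded_sum_cochains:
  assumes "f \<in> graded_sum (cscale scale) (cochains scale)"
  shows "finite (degrees f)" and "component p f \<in> cochains scale p"
proof -
  have "finite (degrees f) \<and> (\<forall>p. component p f \<in> cochains scale p)"
    using assms unfolding graded_sum_def
  proof (induction rule: module.span_induct_alt[OF module_cscale, consumes 1])
    case 1
    then show ?case by (simp add: degrees_def flip: zero_fun_def)
  next
    case (2 c f g)
    then obtain p where f: "f \<in> cochains scale p" by auto
    have "degrees (cscale scale c f + g) \<subseteq> {p} \<union> degrees g"
      using degrees_add degrees_cscale degrees_homogeneous[OF f] by blast
    moreover have "component q (cscale scale c f + g) \<in> cochains scale q" for q
      using 2 f by (auto simp: component_add component_cscale component_homogeneous[OF f]
          intro!: add_in_cochains scale_in_cochains)
    moreover have "finite (degrees g)" using 2 by blast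
    ultimately show ?case
      using finite_subset[of "degrees (cscale scale c f + g)" "{p} \<union> degrees g"] by (simp add: plus_fun_def)
  qed
  then show "finite (degrees f)" "component p f \<in> cochains scale p" by auto
qed

lemma homogeneous_in_graded_sum:
  "f \<in> cochains scale p \<Longrightarrow> f \<in> graded_sum (cscale scale) (cochains scale)"
  unfolding graded_sum_def by (rule module.span_base[OF module_cscale]) blast

text \<open>The sets \<open>degrees\<close> can shrink under sums and scalings. Over a larger finite
  range the added terms have a zero component and vanish, so brackets of different elements can be
  compared term by term.\<close>

lemma gbracket_superset:
  assumes "f \<in> graded_sum (cscale scale) (cochains scale)" "g \<in> graded_sum (cscale scale) (cochains scale)"
    and "finite P" "degrees f \<subseteq> P" "finite Q" "degrees g \<subseteq> Q"
  shows "gbracket f g = (\<Sum>p\<in>P. \<Sum>q\<in>Q. hom_bracket p q (component p f) (component q g))"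
proof -
  have "gbracket f g = (\<Sum>p\<in>degrees f. \<Sum>q\<in>Q. hom_bracket p q (component p f) (component q g))"
    unfolding gbracket_def
    by (intro sum.cong refl sum.mono_neutral_left)
      (use assms graded_sum_cochains in \<open>auto simp: degrees_def\<close>)
  also have "\<dots> = (\<Sum>p\<in>P. \<Sum>q\<in>Q. hom_bracket p q (component p f) (component q g))"
    by (intro sum.mono_neutral_left)
      (use assms graded_sum_cochains in \<open>auto simp: degrees_def\<close>)
  finally show ?thesis .
qed

lemma gbracket_homogeneous:
  assumes "f \<in> cochains scale p" "g \<in> cochains scale q"
  shows "gbracket f g = hom_bracket p q f g"
  using gbracket_superset[of f g "{p}" "{q}"] assms homogeneous_in_graded_sum degrees_homogeneous
  by (simp add: component_homogeneous)

lemma gbracket_add_left: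
  assumes f: "f \<in> graded_sum (cscale scale) (cochains scale)"
    and f': "f' \<in> graded_sum (cscale scale) (cochains scale)"
    and g: "g \<in> graded_sum (cscale scale) (cochains scale)"
  shows "gbracket (f + f') g = gbracket f g + gbracket f' g"
proof -
  define P where "P = degrees f \<union> degrees f'"
  have P: "finite P" "degrees f \<subseteq> P" "degrees f' \<subseteq> P" "degrees (f + f') \<subseteq> P"
    using degrees_add[of f f'] graded_sum_cochains f f' by (auto simp: P_def)
  have "f + f' \<in> graded_sum (cscale scale) (cochains scale)"
    using f f' unfolding graded_sum_def by (rule module.span_add[OF module_cscale])
  then show ?thesis
    using f f' g P graded_sum_cochains
    by (simp add: gbracket_superset[of _ _ P "degrees g"] component_add hom_bracket_add_left sum.distrib)
qed

lemma gbracket_add_right: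
  assumes f: "f \<in> graded_sum (cscale scale) (cochains scale)"
    and g: "g \<in> graded_sum (cscale scale) (cochains scale)"
    and g': "g' \<in> graded_sum (cscale scale) (cochains scale)"
  shows "gbracket f (g + g') = gbracket f g + gbracket f g'"
proof -
  define Q where "Q = degrees g \<union> degrees g'"
  have Q: "finite Q" "degrees g \<subseteq> Q" "degrees g' \<subseteq> Q" "degrees (g + g') \<subseteq> Q"
    using degrees_add[of g g'] graded_sum_cochains g g' by (auto simp: Q_def)
  have "g + g' \<in> graded_sum (cscale scale) (cochains scale)"
    using g g' unfolding graded_sum_def by (rule module.span_add[OF module_cscale])
  then show ?thesis
    using f g g' Q graded_sum_cochains
    by (simp add: gbracket_superset[of _ _ "degrees f" Q] component_add hom_bracket_add_right sum.distrib)
qed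

lemma gbracket_scale:
  assumes f: "f \<in> graded_sum (cscale scale) (cochains scale)"
    and g: "g \<in> graded_sum (cscale scale) (cochains scale)"
  shows "gbracket (cscale scale c f) g = cscale scale c (gbracket f g)"
    and "gbracket f (cscale scale c g) = cscale scale c (gbracket f g)"
proof -
  have "cscale scale c f \<in> graded_sum (cscale scale) (cochains scale)"
    "cscale scale c g \<in> graded_sum (cscale scale) (cochains scale)"
    using f g unfolding graded_sum_def by (blast intro: module.span_scale[OF module_cscale])+
  then show "gbracket (cscale scale c f) g = cscale scale c (gbracket f g)"
    and "gbracket f (cscale scale c g) = cscale scale c (gbracket f g)"
    using f g graded_sum_cochains degrees_cscale
    by (simp_all add: gbracket_superset[of _ _ "degrees f" "degrees g"] component_cscale
        hom_bracket_scale_left hom_bracket_scale_right module.scale_sum_right[OF module_cscale])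
qed

lemma graded_lie_algebra_cochains:
  "graded_lie_algebra (cscale scale) (cochains scale) gbracket"
proof (intro graded_lie_algebra.intro graded_module.intro graded_module_axioms.intro
    graded_lie_algebra_axioms.intro)
  show "module (cscale scale)" by (rule module_cscale)
  show "module.subspace (cscale scale) (cochains scale p)" for p by (rule subspace_cochains)
  show "f p = 0" if P: "finite P" and f: "\<And>p. p \<in> P \<Longrightarrow> f p \<in> cochains scale p"
    and sum: "(\<Sum>p\<in>P. f p) = 0" and p: "p \<in> P" for P p and f :: "int \<Rightarrow> 'b cochain"
  proof -
    \<comment> \<open>Taking \<open>component p\<close> isolates one summand of the vanishing
      sum.\<close>
    have "f p = (\<Sum>q\<in>P. component p (f q))"
      using P p by (simp add: component_homogeneous[OF f] sum.delta cong: sum.cong)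
    also have "\<dots> = component p (\<Sum>q\<in>P. f q)"
      by (simp add: additive.sum[OF additive.intro, of "component p"] component_add)
    also have "\<dots> = 0" by (simp add: sum)
    finally show ?thesis .
  qed
next
  fix p q r f g h
  assume f: "f \<in> cochains scale p" and g: "g \<in> cochains scale q"
  note fg = gbracket_homogeneous[OF f g] hom_bracket_in_cochains[OF f g]
  show "gbracket f g \<in> cochains scale (p + q)"
    using fg by simp
  show "gbracket f g = - koszul (p * q) (gbracket g f)"
    unfolding fg gbracket_homogeneous[OF g f]
    by (simp add: hom_bracket_def koszul_def mult.commute)
  assume h: "h \<in> cochains scale r"
  note fh = gbracket_homogeneous[OF f h] hom_bracket_in_cochains[OF f h]
    and gh = gbracket_homogeneous[OF g h] hom_bracket_in_cochains[OF g h]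
  show "gbracket f (gbracket g h) =
      gbracket (gbracket f g) h + koszul (p * q) (gbracket g (gbracket f h))"
    unfolding fg(1) fh(1) gh(1) gbracket_homogeneous[OF f gh(2)] gbracket_homogeneous[OF fg(2) h]
      gbracket_homogeneous[OF g fh(2)]
    by (rule hom_bracket_jacobi[OF f g h])
qed (fact gbracket_add_left gbracket_add_right gbracket_scale)+


section \<open>The identity and multiplication cochains\<close>

lemma id_cochain_in_cochains: "id_cochain \<in> cochains scale 0"
proof (rule cochainsI)
  fix xs ys :: "'b list" assume "int (length xs + 1 + length ys) = 0 + 1"
  then have "length xs = 0 \<and> length ys = 0" by linarith
  then have "xs = []" "ys = []" by simp_all
  then show "module_hom scale scale (\<lambda>x. id_cochain (xs @ x # ys))"
    by (simp add: id_cochain_def module_hom_ident)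
qed (auto simp: id_cochain_def split: list.split)

lemma mult_cochain_in_cochains:
  assumes "\<And>y. module_hom scale scale (\<lambda>x. \<mu> x y)" and "\<And>x. module_hom scale scale (\<lambda>y. \<mu> x y)"
  shows "mult_cochain \<mu> \<in> cochains scale 1"
proof (rule cochainsI)
  fix xs ys :: "'b list" assume "int (length xs + 1 + length ys) = 1 + 1"
  then have "length xs + length ys = 1" by simp
  then consider a where "xs = [a]" "ys = []" | a where "xs = []" "ys = [a]"
    by (auto simp: add_is_1 length_Suc_conv)
  then show "module_hom scale scale (\<lambda>x. mult_cochain \<mu> (xs @ x # ys))"
    by cases (simp_all add: mult_cochain_def assms)
qed (auto simp: mult_cochain_def split: list.split)

text \<open>Composing \<open>id_cochain\<close> with \<open>f\<close> gives \<open>f\<close>.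
  Inserting it into any of the \<open>p + 1\<close> slots of \<open>f\<close> also gives
  \<open>f\<close>, always with a plus sign because its degree is 0. The commutator is therefore
  \<open>1 - (p + 1)\<close> times \<open>f\<close>.\<close>

lemma gbracket_id_cochain:
  assumes f: "f \<in> cochains scale p"
  shows "gbracket id_cochain f = cscale scale (of_int (- p)) f"
proof -
  have id: "circ 0 p id_cochain f = f"
    using cochains_eq_0[OF f] by (auto simp: circ_def partial_circ_def id_cochain_def fun_eq_iff)
  have "circ p 0 f id_cochain = cscale scale (of_int (p + 1)) f"
    using f
  proof (cases rule: cochains_cases)
    case 1
    then show ?thesis by (simp add: module.scale_zero_right[OF module_cscale])
  next
    case (2 m)
    have "contract i 1 id_cochain as = as" if "i < length as" for i and as :: "'b list"
    proof -
      have "take 1 (drop i as) = [as ! i]"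
        using that by (simp add: take_Suc_conv_app_nth[of 0] hd_drop_conv_nth take_Suc)
      then show ?thesis
        using that id_take_nth_drop[of i as] by (simp add: contract_def id_cochain_def)
    qed
    then show ?thesis
      using cochains_eq_0[OF f] circ_arity[of m 1 f id_cochain]
      by (auto simp: 2 cscale_def fun_eq_iff sum_constant_scale simp del: sum_constant)
  qed
  then show ?thesis
    using module.scale_left_diff_distrib[OF module_cscale, of 1 "of_int (p + 1)" f]
    by (simp add: gbracket_homogeneous[OF id_cochain_in_cochains f] hom_bracket_def id
        module.scale_one[OF module_cscale])
qed

end

section \<open>Quasi-differentials in an abstract graded Lie algebra\<close>

text \<open>Each part is a submodule, so scalars are absorbed into the homogeneous case. Membership
  in the span is carried along because the additive laws are imposed only on the graded sum.\<close>

lemma (in graded_module) graded_sum_induct [consumes 1, case_names homogeneous add]: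
  assumes "x \<in> graded_sum scale C"
    and hom: "\<And>p x. x \<in> C p \<Longrightarrow> P x"
    and add: "\<And>x y. \<lbrakk>x \<in> graded_sum scale C; y \<in> graded_sum scale C; P x; P y\<rbrakk> \<Longrightarrow> P (x + y)"
  shows "P x"
proof -
  have "x \<in> span (\<Union>p. C p) \<and> P x"
    using assms(1) unfolding graded_sum_def
  proof (induction rule: span_induct_alt)
    case base
    show ?case using hom[OF subspace_0[OF subspace_part]] span_zero by blast
  next
    case (step c x y)
    then obtain p where x: "scale c x \<in> C p" using subspace_scale[OF subspace_part] by blast
    then have "scale c x \<in> span (\<Union>p. C p)" by (blast intro: span_base)
    then show ?case
      using step hom[OF x] add[of "scale c x" y] by (simp add: graded_sum_def span_add)
  qed
  then show ?thesis ..
qed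

lemma (in graded_module) homogeneous_in_sum: "x \<in> C p \<Longrightarrow> x \<in> graded_sum scale C"
  by (auto simp: graded_sum_def intro: span_base)

lemma (in graded_module) add_in_sum:
  "\<lbrakk>x \<in> graded_sum scale C; y \<in> graded_sum scale C\<rbrakk> \<Longrightarrow> x + y \<in> graded_sum scale C"
  by (simp add: graded_sum_def span_add)

text \<open>The graded Jacobi identity with \<open>\<mu>\<close> of degree 1 in the first slot is
  the derivation law for \<open>br \<mu>\<close>.\<close>

lemma (in graded_lie_algebra) quasi_dgla_inner:
  assumes \<mu>: "\<mu> \<in> C 1"
  shows "quasi_dgla scale C br (br \<mu>)"
proof
  show "br \<mu> (br x y) = br (br \<mu> x) y + koszul p (br x (br \<mu> y))" if "x \<in> C p" "y \<in> C q" for x y p q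
    using br_jacobi[OF \<mu> that] by simp
  show "br \<mu> x \<in> C (p + 1)" if "x \<in> C p" for x p
    using br_degree[OF \<mu> that] by (simp add: add.commute)
qed (use homogeneous_in_sum[OF \<mu>] br_add_right br_scale_right in auto)

lemma (in quasi_dgla) d_in_sum: "x \<in> graded_sum scale C \<Longrightarrow> d x \<in> graded_sum scale C"
  by (induction rule: graded_sum_induct) (auto simp: d_add intro: add_in_sum homogeneous_in_sum d_degree)

context coboundary_quasi_dgla
begin

lemma d_torsion: "d (d I) = br (d I) (d I)"
  by (intro d_inner d_in_sum homogeneous_in_sum[OF I_degree])

text \<open>For homogeneous \<open>s\<close> the derivation law on \<open>d s = br (d I) s\<close>
  gives twice \<open>br \<alpha> s\<close> minus \<open>br (d I) (d s)\<close>, and this last term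
  is \<open>d (d s)\<close> again. So twice the difference of the two sides is zero, and additivity
  covers sums.\<close>

lemma d_squared:
  assumes \<alpha>: "\<alpha> \<in> C 2" "scale 2 \<alpha> = d (d I)"
    and inj: "\<And>x. scale 2 x = 0 \<Longrightarrow> x = 0"
    and s: "s \<in> graded_sum scale C"
  shows "d (d s) = br \<alpha> s"
  using s
proof (induction rule: graded_sum_induct)
  case (homogeneous p s)
  have \<mu>: "d I \<in> C 1" using d_degree[OF I_degree] by simp
  have s: "s \<in> graded_sum scale C" and ds: "d s \<in> graded_sum scale C"
    using homogeneous d_degree homogeneous_in_sum by blast+
  have "d (d s) = d (br (d I) s)" using d_inner[OF s] by simp
  also have "\<dots> = br (scale 2 \<alpha>) s - br (d I) (d s)"
    using d_derivation[OF \<mu> homogeneous] \<alpha> by (simp add: koszul_def)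
  also have "\<dots> = scale 2 (br \<alpha> s) - d (d s)"
    using homogeneous_in_sum[OF \<alpha>(1)] s d_inner[OF ds] by (simp add: br_scale_left)
  finally have "d (d s) + d (d s) = scale 2 (br \<alpha> s)"
    by (simp only: eq_diff_eq)
  then have "scale 2 (d (d s) - br \<alpha> s) = 0"
    using scale_left_distrib[of 1 1 "d (d s)"] by (simp add: scale_right_diff_distrib)
  then show ?case using inj by force
next
  case (add x y)
  then show ?case
    using homogeneous_in_sum[OF \<alpha>(1)] by (simp add: d_add d_in_sum br_add_right)
qed

text \<open>The derivation law on \<open>d (d I) = br (d I) (d I)\<close> gives two terms, each
  equal to \<open>- d (d (d I))\<close>: the second because \<open>d\<close> is inner, the first by
  antisymmetry in degrees 2 and 1. Thus 3 annihilates \<open>d (d (d I))\<close>, which is twice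
  \<open>d \<alpha>\<close>.\<close>

lemma d_curvature:
  assumes \<alpha>: "\<alpha> \<in> C 2" "scale 2 \<alpha> = d (d I)"
    and inj2: "\<And>x. scale 2 x = 0 \<Longrightarrow> x = 0"
    and inj3: "\<And>x. scale 3 x = 0 \<Longrightarrow> x = 0"
  shows "d \<alpha> = 0"
proof -
  have \<mu>: "d I \<in> C 1" and d\<mu>: "d (d I) \<in> C 2"
    using d_degree[OF I_degree] d_degree[of "d I" 1] by simp_all
  have "d (d (d I)) = br (d (d I)) (d I) - br (d I) (d (d I))"
    using d_derivation[OF \<mu> \<mu>] by (simp add: d_torsion koszul_def)
  moreover have "br (d (d I)) (d I) = - br (d I) (d (d I))"
    using br_antisym[OF d\<mu> \<mu>] by (simp add: koszul_def)
  moreover have "br (d I) (d (d I)) = d (d (d I))"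
    by (rule d_inner[symmetric, OF homogeneous_in_sum[OF d\<mu>]])
  ultimately have "d (d (d I)) + d (d (d I)) + d (d (d I)) = 0"
    by (simp add: algebra_simps)
  then have "scale 3 (d (d (d I))) = 0"
    using scale_left_distrib[of 1 1 "d (d (d I))"] scale_left_distrib[of 2 1 "d (d (d I))"] by simp
  then have "scale 2 (d \<alpha>) = 0"
    using inj3 d_scale[OF homogeneous_in_sum[OF \<alpha>(1)], of 2] \<alpha>(2) by simp
  then show ?thesis by (rule inj2)
qed

end

theorem proposition2p1:
  fixes scale :: "'r::comm_ring_1 \<Rightarrow> 'a::ab_group_add \<Rightarrow> 'a"
    and \<mu> :: "'a \<Rightarrow> 'a \<Rightarrow> 'a"
  assumes "module scale"
    and "\<And>a. scale 2 a = 0 \<Longrightarrow> a = 0"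
    and "\<And>a. scale 3 a = 0 \<Longrightarrow> a = 0"
    and "\<And>y. module_hom scale scale (\<lambda>x. \<mu> x y)"
    and "\<And>x. module_hom scale scale (\<lambda>y. \<mu> x y)"
  shows "coboundary_quasi_dgla (cscale scale) (cochains scale) gbracket (hochschild_d \<mu>) id_cochain
    \<and> hochschild_d \<mu> id_cochain = mult_cochain \<mu>
    \<and> (\<forall>p. \<forall>f \<in> cochains scale p. gbracket id_cochain f = cscale scale (of_int (- p)) f)
    \<and> (\<exists>!\<alpha>. \<alpha> \<in> cochains scale 2 \<and> cscale scale 2 \<alpha> = hochschild_d \<mu> (mult_cochain \<mu>))
    \<and> associator scale \<mu> \<in> cochains scale 2
    \<and> cscale scale 2 (associator scale \<mu>) = hochschild_d \<mu> (mult_cochain \<mu>)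
    \<and> (\<forall>x y z. associator scale \<mu> [x, y, z] = \<mu> (\<mu> x y) z - \<mu> x (\<mu> y z))
    \<and> hochschild_d \<mu> (associator scale \<mu>) = 0
    \<and> (\<forall>s \<in> graded_sum (cscale scale) (cochains scale).
         hochschild_d \<mu> (hochschild_d \<mu> s) = gbracket (associator scale \<mu>) s)"
proof -
  interpret module scale by (rule assms(1))
  interpret L: graded_lie_algebra "cscale scale" "cochains scale" gbracket
    by (rule graded_lie_algebra_cochains)
  define m where "m = mult_cochain \<mu>"
  have m: "m \<in> cochains scale 1"
    unfolding m_def by (rule mult_cochain_in_cochains[OF assms(4,5)])
  have d: "hochschild_d \<mu> = gbracket m"
    by (simp add: hochschild_d_def m_def)
  \<comment> \<open>Bracketing with \<open>id_cochain\<close> is multiplication by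
    \<open>- 1\<close> on degree 1, so antisymmetry returns \<open>m\<close> itself.\<close>
  have "gbracket m id_cochain = - gbracket id_cochain m"
    using L.br_antisym[OF m id_cochain_in_cochains] by simp
  also have "\<dots> = m"
    using gbracket_id_cochain[OF m] by (simp add: cscale_def fun_eq_iff)
  finally have dI: "gbracket m id_cochain = m" .
  have coboundary: "coboundary_quasi_dgla (cscale scale) (cochains scale) gbracket (gbracket m) id_cochain"
    by (intro coboundary_quasi_dgla.intro coboundary_quasi_dgla_axioms.intro L.quasi_dgla_inner[OF m]
        id_cochain_in_cochains) (simp only: dI)
  \<comment> \<open>Absence of 2-torsion, and then of 3-torsion, passes pointwise from the module to
    its cochains.\<close>
  have inj2: "f = 0" if "cscale scale 2 f = 0" for f :: "'a cochain"
  proof (rule ext)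
    show "f as = 0 as" for as
      using assms(2)[of "f as"] fun_cong[OF that, of as] by (simp add: cscale_def)
  qed
  have inj3: "f = 0" if "cscale scale 3 f = 0" for f :: "'a cochain"
  proof (rule ext)
    show "f as = 0 as" for as
      using assms(3)[of "f as"] fun_cong[OF that, of as] by (simp add: cscale_def)
  qed
  \<comment> \<open>Since \<open>m\<close> has odd degree, its commutator with itself is twice this
    composite, which makes it the candidate for the curvature.\<close>
  define \<alpha> where "\<alpha> = circ 1 1 m m"
  have \<alpha>: "\<alpha> \<in> cochains scale 2"
    using circ_in_cochains[OF m m] by (simp add: \<alpha>_def)
  have "gbracket m m = \<alpha> + \<alpha>"
    by (simp add: gbracket_homogeneous[OF m m] hom_bracket_def \<alpha>_def koszul_def)
  then have \<alpha>2: "cscale scale 2 \<alpha> = gbracket m m"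
    using scale_left_distrib[of 1 1] by (simp add: cscale_def fun_eq_iff)
  have unique: "\<beta> = \<alpha>" if "cscale scale 2 \<beta> = gbracket m m" for \<beta>
    using inj2[of "\<beta> - \<alpha>"] that \<alpha>2 by (simp add: L.scale_right_diff_distrib)
  \<comment> \<open>Existence by \<open>\<alpha>2\<close> and uniqueness by absence of 2-torsion
    give the definite description in \<open>curvature\<close> its meaning.\<close>
  have assoc: "associator scale \<mu> = \<alpha>"
    unfolding associator_def curvature_def d dI
    by (rule the_equality) (use \<alpha> \<alpha>2 unique in blast)+
  \<comment> \<open>The first slot contributes \<open>\<mu> (\<mu> x y) z\<close> with a plus sign,
    the second \<open>\<mu> x (\<mu> y z)\<close> with a minus sign, as \<open>m\<close> has degree
    1.\<close>
  have "\<alpha> [x, y, z] = \<mu> (\<mu> x y) z - \<mu> x (\<mu> y z)" for x y z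
    by (simp add: \<alpha>_def m_def circ_def partial_circ_def mult_cochain_def koszul_def numeral_2_eq_2)
  moreover have "gbracket m \<alpha> = 0"
    using coboundary_quasi_dgla.d_curvature[OF coboundary \<alpha> _ inj2 inj3] \<alpha>2 by (simp add: dI)
  moreover have "gbracket m (gbracket m s) = gbracket \<alpha> s"
    if "s \<in> graded_sum (cscale scale) (cochains scale)" for s
    using coboundary_quasi_dgla.d_squared[OF coboundary \<alpha> _ inj2 that] \<alpha>2 by (simp add: dI)
  ultimately show ?thesis
    unfolding d assoc m_def[symmetric]
    using coboundary dI gbracket_id_cochain \<alpha> \<alpha>2 unique by blast
qed

end
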